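(* For any $A$-labeled pair of twin binary search trees $(T_L, T_R)$ as input, the algorithm ExtractBaxter computes a word belonging to the $\equiv_{\mathrm{B}}$-equivalence class encoded by $(T_L, T_R)$. Moreover, if $(T_L, T_R)$ is labeled by a permutation, the computed word is a Baxter permutation.
   Context: $A = \{a_1 < a_2 < \cdots\}$ is a totally ordered infinite alphabet and $A^*$ is the free monoid of words on $A$. The Baxter congruence $\equiv_{\mathrm{B}}$ is the smallest congruence (equivalence relation compatible with concatenation) on $A^*$ such that, for all words $u, v$ and letters $a,b,c,d$: $\; c\,u\,a d\,v\,b \equiv_{\mathrm{B}} c\,u\,d a\,v\,b$ whenever $a \leq b < c \leq d$, and $\; b\,u\,d a\,v\,c \equiv_{\mathrm{B}} b\,u\,a d\,v\,c$ whenever $a < b \leq c < d$. A binary tree is either a leaf (empty tree) or a node with a left and a right binary subtree. The $i$-th node is the $i$-th node visited by the inorder traversal (left subtree, root, right subtree); the inorder reading of a labeled tree is the word of labels in this order. The canopy of a binary tree with $n$ nodes is the word of length $n-1$ obtained by reading its leaves from left to right except the first and the last, writing $0$ if the leaf is a right child and $1$ if it is a left child. Two binary trees $(T_L,T_R)$ with $n$ nodes form a pair of twin binary trees if their canopies differ at every position $1\le i\le n-1$. A tree labeled by $A$ is a right (resp. left) binary search tree if for each node labeled $b$, all labels $a$ in its left subtree and $c$ in its right subtree satisfy $a \leq b < c$ (resp. $a < b \leq c$). A pair of twin binary search trees is an $A$-labeled pair of twin binary trees $(T_L,T_R)$ with $T_L$ a left binary search tree, $T_R$ a right binary search tree, and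 both having the same inorder reading. It is labeled by a permutation if the labels of each tree with $n$ nodes are $1,\dots,n$, each used once. Leaf insertion of a letter $a$ into a right (resp. left) binary search tree: in the empty tree, create a node labeled $a$; otherwise, with $b$ the root label, insert recursively into the left subtree if $a \leq b$ (resp. $a<b$), and into the right subtree otherwise. For $u \in A^*$, $\mathsf{P}(u) = (T_L,T_R)$ where $T_L$ (resp. $T_R$) is the left (resp. right) binary search tree obtained by leaf inserting the letters of $u$ from left to right (resp. right to left). The class encoded by $(T_L,T_R)$ is the $\equiv_{\mathrm{B}}$-equivalence class of the words $u$ with $\mathsf{P}(u) = (T_L,T_R)$. A permutation $\sigma$ is a Baxter permutation if for any subword $u_1u_2u_3u_4$ of $\sigma$ such that $u_2$ and $u_3$ are adjacent in $\sigma$, the standardization of $u_1u_2u_3u_4$ is neither $2413$ nor $3142$. For binary trees $T_0,T_1$ (labeled or not), $T_0 / T_1$ is obtained by grafting $T_0$ from its root on the leftmost leaf of $T_1$, and $T_0 \backslash T_1$ by grafting $T_1$ from its root on the rightmost leaf of $T_0$. Algorithm ExtractBaxter, on input $(T_L,T_R)$: (1) let $u$ be the empty word. (2) While $T_L$ and $T_R$ are not empty: (a) let $a$ be the label of the root of $T_L$; (b) let $i$ be the (inorder) index of the root of $T_L$; (c) set $u := u a$; (d) let $A'$ (resp. $B'$) be the left (resp. right) subtree of $T_L$; (e) if the $i$-th node of $T_R$ is a left child in $T_R$, set $T_L := A' / B'$, otherwise set $T_L := A' \backslash B'$; (f) suppress the $i$-th node in $T_R$ (this node has no child in $T_R$).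 (3) Return $u$. *)

theory Defs
  imports "HOL-Library.Tree" "HOL-Library.Infinite_Typeclass"
begin

section \<open>The Baxter congruence\<close>

inductive baxter_cong :: "'a::linorder list \<Rightarrow> 'a list \<Rightarrow> bool"  (infix "\<equiv>B" 50) where
  refl: "u \<equiv>B u"
| sym: "u \<equiv>B v \<Longrightarrow> v \<equiv>B u"
| trans: "u \<equiv>B v \<Longrightarrow> v \<equiv>B w \<Longrightarrow> u \<equiv>B w"
| append: "u \<equiv>B u' \<Longrightarrow> v \<equiv>B v' \<Longrightarrow> u @ v \<equiv>B u' @ v'"
| adj1: "a \<le> b \<Longrightarrow> b < c \<Longrightarrow> c \<le> d \<Longrightarrow>
    [c] @ u @ [a, d] @ v @ [b] \<equiv>B [c] @ u @ [d, a] @ v @ [b]"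
| adj2: "a < b \<Longrightarrow> b \<le> c \<Longrightarrow> c < d \<Longrightarrow>
    [b] @ u @ [d, a] @ v @ [c] \<equiv>B [b] @ u @ [a, d] @ v @ [c]"


section \<open>Pairs of twin binary search trees\<close>

text \<open>One entry per leaf, from left to right: 1 if the leaf is a left child, 0 if it is a right
  child. The first argument is the entry used when the tree itself is a leaf.\<close>

fun leaf_bits :: "nat \<Rightarrow> 'a tree \<Rightarrow> nat list" where
  "leaf_bits d Leaf = [d]"
| "leaf_bits d (Node l x r) = leaf_bits 1 l @ leaf_bits 0 r"

text \<open>The outermost leaves are dropped, so the initial entry 0 below is never visible.\<close>

definition canopy :: "'a tree \<Rightarrow> nat list" where
  "canopy t = butlast (tl (leaf_bits 0 t))"

definition twin_trees :: "'a tree \<Rightarrow> 'b tree \<Rightarrow> bool" where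
  "twin_trees TL TR \<longleftrightarrow> size TL = size TR \<and>
     (\<forall>i < size TL - 1. canopy TL ! i \<noteq> canopy TR ! i)"

fun left_bst :: "'a::linorder tree \<Rightarrow> bool" where
  "left_bst Leaf = True"
| "left_bst (Node l b r) \<longleftrightarrow> left_bst l \<and> left_bst r \<and>
     (\<forall>a \<in> set_tree l. a < b) \<and> (\<forall>c \<in> set_tree r. b \<le> c)"

fun right_bst :: "'a::linorder tree \<Rightarrow> bool" where
  "right_bst Leaf = True"
| "right_bst (Node l b r) \<longleftrightarrow> right_bst l \<and> right_bst r \<and>
     (\<forall>a \<in> set_tree l. a \<le> b) \<and> (\<forall>c \<in> set_tree r. b < c)"

definition twin_bsts :: "'a::linorder tree \<Rightarrow> 'a tree \<Rightarrow> bool" where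
  "twin_bsts TL TR \<longleftrightarrow> twin_trees TL TR \<and> left_bst TL \<and> right_bst TR \<and> inorder TL = inorder TR"

definition permutation_labeled :: "nat tree \<Rightarrow> bool" where
  "permutation_labeled t \<longleftrightarrow> distinct (inorder t) \<and> set_tree t = {1..size t}"


section \<open>The P-symbol and the encoded class\<close>

fun left_insert :: "'a::linorder \<Rightarrow> 'a tree \<Rightarrow> 'a tree" where
  "left_insert a Leaf = Node Leaf a Leaf"
| "left_insert a (Node l b r) =
     (if a < b then Node (left_insert a l) b r else Node l b (left_insert a r))"

fun right_insert :: "'a::linorder \<Rightarrow> 'a tree \<Rightarrow> 'a tree" where
  "right_insert a Leaf = Node Leaf a Leaf"
| "right_insert a (Node l b r) =
     (if a \<le> b then Node (right_insert a l) b r else Node l b (right_insert a r))"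

text \<open>\<open>foldr\<close> inserts the last letter first.\<close>

definition P_symbol :: "'a::linorder list \<Rightarrow> 'a tree \<times> 'a tree" where
  "P_symbol u = (fold left_insert u Leaf, foldr right_insert u Leaf)"

text \<open>The union of the \<open>\<equiv>B\<close>-classes of the words with the given P-symbol; such words are
  all equivalent, so this is a single class whenever there is such a word.\<close>

definition encoded_class :: "'a::linorder tree \<Rightarrow> 'a tree \<Rightarrow> 'a list set" where
  "encoded_class TL TR = (\<Union>u \<in> {u. P_symbol u = (TL, TR)}. {w. u \<equiv>B w})"


section \<open>Baxter permutations\<close>

definition standardization :: "'a::linorder list \<Rightarrow> nat list" where
  "standardization u =
     map (\<lambda>i. card {j. j < length u \<and> (u ! j < u ! i \<or> (u ! j = u ! i \<and> j \<le> i))}) [0..<length u]"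

definition baxter_permutation :: "nat list \<Rightarrow> bool" where
  "baxter_permutation \<sigma> \<longleftrightarrow> distinct \<sigma> \<and> set \<sigma> = {1..length \<sigma>} \<and>
     (\<forall>i j k. i < j \<and> j + 1 < k \<and> k < length \<sigma> \<longrightarrow>
        standardization [\<sigma> ! i, \<sigma> ! j, \<sigma> ! (j + 1), \<sigma> ! k] \<notin> {[2, 4, 1, 3], [3, 1, 4, 2]})"


section \<open>The algorithm\<close>

text \<open>\<open>over\<close> is \<open>T0 / T1\<close> and \<open>under\<close> is \<open>T0 \ T1\<close>.\<close>

fun over :: "'a tree \<Rightarrow> 'a tree \<Rightarrow> 'a tree" where
  "over T0 Leaf = T0"
| "over T0 (Node l x r) = Node (over T0 l) x r"

fun under :: "'a tree \<Rightarrow> 'a tree \<Rightarrow> 'a tree" where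
  "under Leaf T1 = T1"
| "under (Node l x r) T1 = Node l x (under r T1)"

text \<open>One entry per node, in inorder, telling whether the node is a left child. The first
  argument is the entry of the root, which is \<open>False\<close> for a whole tree.\<close>

fun left_child_flags :: "bool \<Rightarrow> 'a tree \<Rightarrow> bool list" where
  "left_child_flags d Leaf = []"
| "left_child_flags d (Node l x r) = left_child_flags True l @ [d] @ left_child_flags False r"

definition is_left_child :: "nat \<Rightarrow> 'a tree \<Rightarrow> bool" where
  "is_left_child i t = left_child_flags False t ! (i - 1)"

text \<open>Suppression of the \<open>i\<close>-th node (counted from 1), which fails if there is no such node or
  if it has a child.\<close>

fun suppress :: "nat \<Rightarrow> 'a tree \<Rightarrow> 'a tree option" where
  "suppress i Leaf = None"
| "suppress i (Node l x r) =
     (if i \<le> size l then map_option (\<lambda>l'. Node l' x r) (suppress i l)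
      else if i = size l + 1 then (if l = Leaf \<and> r = Leaf then Some Leaf else None)
      else map_option (\<lambda>r'. Node l x r') (suppress (i - (size l + 1)) r))"

lemma size_over: "size (over T0 T1) = size T0 + size T1"
  by (induction T0 T1 rule: over.induct) auto

lemma size_under: "size (under T0 T1) = size T0 + size T1"
  by (induction T0 T1 rule: under.induct) auto

text \<open>The while loop; the result is \<open>None\<close> if step (f) fails in some iteration. In step (b),
  the index of the root of \<open>Node A' a B'\<close> is \<open>size A' + 1\<close>.\<close>

function extract_loop :: "'a list \<Rightarrow> 'a tree \<Rightarrow> 'a tree \<Rightarrow> 'a list option" where
  "extract_loop u Leaf TR = Some u"
| "extract_loop u (Node A' a B') Leaf = Some u"
| "extract_loop u (Node A' a B') (Node l x r) =
     (let TR = Node l x r; i = size A' + 1 in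
      case suppress i TR of
        None \<Rightarrow> None
      | Some TR' \<Rightarrow>
          extract_loop (u @ [a]) (if is_left_child i TR then over A' B' else under A' B') TR')"
  by pat_completeness auto
termination
  by (relation "measure (\<lambda>(u, TL, TR). size TL)") (auto simp: size_over size_under)

definition extract_baxter :: "'a tree \<Rightarrow> 'a tree \<Rightarrow> 'a list option" where
  "extract_baxter TL TR = extract_loop [] TL TR"

end

theory Submission
  imports Defs
begin

text \<open>The letters are read off \<open>TL\<close> by repeatedly removing the root and merging its two subtrees
  with \<open>over\<close> or \<open>under\<close>. Whatever the choices, inserting the resulting word rebuilds \<open>TL\<close>,
  because cutting either merged tree at the removed letter gives back the two subtrees. The canopy
  condition says that the node of \<open>TR\<close> at the position of the root of \<open>TL\<close> has no child, and the
  choice made by the algorithm preserves it; reinserting the letter then restores that node.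

  The Baxter property also depends on \<open>TL\<close> only: after the removal of \<open>b\<close>, the tree is the
  \<open>over\<close> or the \<open>under\<close> of a tree with labels \<open>< b\<close> and a tree with labels \<open>\<ge> b\<close>, and this
  survives all later removals. An occurrence of a forbidden pattern around \<open>b\<close> would need a search
  path towards \<open>b\<close> that changes sides twice.\<close>

section \<open>Words read off a tree by repeated removal of the root\<close>

inductive extraction :: "'a tree \<Rightarrow> 'a list \<Rightarrow> bool" where
  "extraction Leaf []"
| "extraction (over l r) w \<Longrightarrow> extraction (Node l a r) (a # w)"
| "extraction (under l r) w \<Longrightarrow> extraction (Node l a r) (a # w)"

lemma over_Leaf_left [simp]: "over Leaf t = t"
  by (induction t) auto

lemma under_Leaf_right [simp]: "under t Leaf = t"
  by (induction t) auto

lemma over_assoc: "over (over s t) u = over s (over t u)"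
  by (induction u) auto

lemma under_assoc: "under (under s t) u = under s (under t u)"
  by (induction s) auto

lemma inorder_over [simp]: "inorder (over s t) = inorder s @ inorder t"
  by (induction t) auto

lemma inorder_under [simp]: "inorder (under s t) = inorder s @ inorder t"
  by (induction s) auto

lemma set_tree_over [simp]: "set_tree (over s t) = set_tree s \<union> set_tree t"
  by (induction t) auto

lemma set_tree_under [simp]: "set_tree (under s t) = set_tree s \<union> set_tree t"
  by (induction s) auto

lemma left_bst_over:
  "left_bst s \<Longrightarrow> left_bst t \<Longrightarrow> \<forall>x\<in>set_tree s. \<forall>y\<in>set_tree t. x < y \<Longrightarrow> left_bst (over s t)"
  by (induction t) auto

lemma left_bst_under:
  "left_bst s \<Longrightarrow> left_bst t \<Longrightarrow> \<forall>x\<in>set_tree s. \<forall>y\<in>set_tree t. x < y \<Longrightarrow> left_bst (under s t)"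
  by (induction s) (auto intro: less_imp_le)

lemma left_bst_merge:
  assumes "left_bst (Node l a r)" "s = over l r \<or> s = under l r"
  shows "left_bst s"
  using assms by (auto intro!: left_bst_over left_bst_under intro: less_le_trans)

lemma extraction_set: "extraction t w \<Longrightarrow> set w = set_tree t"
  by (induction rule: extraction.induct) auto

lemma extraction_length: "extraction t w \<Longrightarrow> length w = size t"
  by (induction rule: extraction.induct) (auto simp: size_over size_under)


section \<open>The left tree\<close>

text \<open>The two halves of a search tree split at \<open>a\<close>. Labels equal to
  \<open>a\<close> go to \<open>above\<close>, just as \<open>left_insert\<close> sends a letter
  equal to the root to the right.\<close>

fun below :: "'a::linorder \<Rightarrow> 'a tree \<Rightarrow> 'a tree" where
  "below a Leaf = Leaf"
| "below a (Node l b r) = (if b < a then Node l b (below a r) else below a l)"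

fun above :: "'a::linorder \<Rightarrow> 'a tree \<Rightarrow> 'a tree" where
  "above a Leaf = Leaf"
| "above a (Node l b r) = (if b < a then above a r else Node (above a l) b r)"

text \<open>A letter on the other side of \<open>a\<close> lands among the nodes that the cut
  discards, and any other letter follows the same path before and after the cut.\<close>

lemma below_left_insert:
  "below a (left_insert x t) = (if x < a then left_insert x (below a t) else below a t)"
  by (induction t) auto

lemma above_left_insert:
  "above a (left_insert x t) = (if x < a then above a t else left_insert x (above a t))"
  by (induction t) auto

lemma below_fold_left_insert:
  "below a (fold left_insert w t) = fold left_insert (filter (\<lambda>x. x < a) w) (below a t)"
  by (induction w arbitrary: t) (auto simp: below_left_insert)

lemma above_fold_left_insert:
  "above a (fold left_insert w t) = fold left_insert (filter (\<lambda>x. \<not> x < a) w) (above a t)"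
  by (induction w arbitrary: t) (auto simp: above_left_insert)

lemma fold_left_insert_Node:
  "fold left_insert w (Node l a r) =
     Node (fold left_insert (filter (\<lambda>x. x < a) w) l) a (fold left_insert (filter (\<lambda>x. \<not> x < a) w) r)"
  by (induction w arbitrary: l r) auto

lemma below_id: "\<forall>x\<in>set_tree t. x < a \<Longrightarrow> below a t = t"
  by (induction t) auto

lemma below_Leaf: "\<forall>x\<in>set_tree t. a \<le> x \<Longrightarrow> below a t = Leaf"
  by (induction t) auto

lemma above_id: "\<forall>x\<in>set_tree t. a \<le> x \<Longrightarrow> above a t = t"
  by (induction t) auto

lemma above_Leaf: "\<forall>x\<in>set_tree t. x < a \<Longrightarrow> above a t = Leaf"
  by (induction t) auto

text \<open>The cut runs down the left spine of \<open>t\<close>, where all labels are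
  \<open>\<ge> a\<close>, and meets \<open>s\<close> as a whole at its end.\<close>

lemma cut_over:
  assumes "\<forall>x\<in>set_tree s. x < a" "\<forall>x\<in>set_tree t. a \<le> x"
  shows "below a (over s t) = s" "above a (over s t) = t"
  using assms by (induction t) (auto simp: below_id above_Leaf)

lemma cut_under:
  assumes "\<forall>x\<in>set_tree s. x < a" "\<forall>x\<in>set_tree t. a \<le> x"
  shows "below a (under s t) = s" "above a (under s t) = t"
  using assms by (induction s) (auto simp: below_Leaf above_id)

text \<open>The root \<open>a\<close> sorts the later letters to its two sides exactly as the cut
  sorts the tree that they build on their own.\<close>

lemma fold_left_insert_Cons:
  "fold left_insert (a # w) Leaf =
     Node (below a (fold left_insert w Leaf)) a (above a (fold left_insert w Leaf))"
  by (simp add: fold_left_insert_Node below_fold_left_insert above_fold_left_insert)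

lemma fold_left_insert_extraction:
  "extraction t w \<Longrightarrow> left_bst t \<Longrightarrow> fold left_insert w Leaf = t"
proof (induction rule: extraction.induct)
  case (2 l r w a)
  then show ?case
    using left_bst_merge[OF 2(3)] unfolding fold_left_insert_Cons by (simp add: cut_over)
next
  case (3 l r w a)
  then show ?case
    using left_bst_merge[OF 3(3)] unfolding fold_left_insert_Cons by (simp add: cut_under)
qed simp


section \<open>The right tree\<close>

lemma length_leaf_bits [simp]: "length (leaf_bits d t) = Suc (size t)"
  by (induction d t rule: leaf_bits.induct) auto

lemma leaf_bits_not_Nil [simp]: "leaf_bits d t \<noteq> []"
  by (induction d t rule: leaf_bits.induct) auto

lemma leaf_bits_le_1: "d \<le> 1 \<Longrightarrow> k \<le> size t \<Longrightarrow> leaf_bits d t ! k \<le> 1"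
  by (induction d t arbitrary: k rule: leaf_bits.induct) (auto simp: nth_append)

lemma leaf_bits_first: "leaf_bits d t ! 0 = (if t = Leaf then d else 1)"
  by (induction d t rule: leaf_bits.induct) (auto simp: nth_append)

lemma leaf_bits_last: "leaf_bits d t ! size t = (if t = Leaf then d else 0)"
  by (induction d t rule: leaf_bits.induct) (auto simp: nth_append)

lemma leaf_bits_irrelevant: "t \<noteq> Leaf \<Longrightarrow> leaf_bits d t = leaf_bits d' t"
  by (cases t) auto

text \<open>\<open>s\<close> takes the place of the first leaf of \<open>t\<close> and inherits its
  entry, which is 1 unless \<open>t\<close> is itself that leaf.\<close>

lemma leaf_bits_over:
  "leaf_bits d (over s t) = leaf_bits (if t = Leaf then d else 1) s @ tl (leaf_bits d t)"
proof (induction t arbitrary: d)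
  case (Node l x r)
  then show ?case using Node.IH(1)[of 1] by simp
qed simp

lemma leaf_bits_under:
  "leaf_bits d (under s t) = butlast (leaf_bits d s) @ leaf_bits (if s = Leaf then d else 0) t"
proof (induction s arbitrary: d)
  case (Node l x r)
  then show ?case using Node.IH(2)[of 0] by (simp add: butlast_append)
qed simp

text \<open>Leaves \<open>i\<close> and \<open>Suc i\<close> flank the node \<open>i\<close>
  (counted from 0), and the entries 1, 0 make them its children. Suppression merges them into one
  leaf on the side where the node hung, so the new entry is the flag of the node. Taking
  \<open>of_bool d\<close> keeps the default entry and the default flag in step.\<close>

lemma suppress_leaf_bits:
  assumes "i < size t" "leaf_bits (of_bool d) t ! i = 1" "leaf_bits (of_bool d) t ! Suc i = 0"
  shows "\<exists>t'. suppress (Suc i) t = Some t' \<and> Suc (size t') = size t \<and>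
    leaf_bits (of_bool d) t' = take i (leaf_bits (of_bool d) t) @
      of_bool (left_child_flags d t ! i) # drop (Suc (Suc i)) (leaf_bits (of_bool d) t)"
  using assms
proof (induction t arbitrary: d i)
  case (Node l x r)
  have len: "length (left_child_flags c s) = size s" for c and s :: "'a tree"
    by (induction s arbitrary: c) auto
  consider "i < size l" | "i = size l" | j where "i = Suc (size l + j)"
    by (metis add_Suc less_imp_Suc_add linorder_neqE_nat)
  then show ?case
  proof cases
    case 1
    then have "leaf_bits (of_bool True) l ! i = 1" "leaf_bits (of_bool True) l ! Suc i = 0"
      using Node.prems by (auto simp: nth_append)
    from Node.IH(1)[OF 1 this] 1 show ?thesis
      by (auto simp: nth_append len)
  next
    case 2
    then have "leaf_bits 1 l ! size l = 1" "leaf_bits 0 r ! 0 = 0"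
      using Node.prems by (auto simp: nth_append)
    \<comment> \<open>A nonempty \<open>l\<close> would end with entry 0, and a nonempty
      \<open>r\<close> would start with entry 1.\<close>
    then have "l = Leaf" "r = Leaf"
      by (auto simp: leaf_bits_first leaf_bits_last split: if_splits)
    with 2 show ?thesis by simp
  next
    case 3
    then have "j < size r" "leaf_bits (of_bool False) r ! j = 1"
      "leaf_bits (of_bool False) r ! Suc j = 0"
      using Node.prems by (auto simp: nth_append)
    from Node.IH(2)[OF this] 3 show ?thesis
      by (auto simp: nth_append len)
  qed
qed simp

lemma inorder_suppress:
  "suppress (Suc i) t = Some t' \<Longrightarrow> inorder t' = take i (inorder t) @ drop (Suc i) (inorder t)"
proof (induction t arbitrary: i t')
  case (Node l x r)
  consider "i < size l" | "i = size l" | j where "i = Suc (size l + j)"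
    by (metis add_Suc less_imp_Suc_add linorder_neqE_nat)
  then show ?case
    by cases (use Node in \<open>auto split: if_splits\<close>)
qed simp

text \<open>The search for \<open>a\<close> turns right at the labels of \<open>xs\<close> and left
  at those of \<open>ys\<close>, so it ends at the leaf that replaced the suppressed node.\<close>

lemma right_insert_suppress:
  assumes "suppress (Suc (length xs)) t = Some t'" "inorder t = xs @ a # ys"
    "\<forall>x\<in>set xs. x < a" "\<forall>y\<in>set ys. a \<le> y"
  shows "right_insert a t' = t"
  using assms
proof (induction t arbitrary: xs ys t')
  case (Node l x r)
  consider "length xs < size l" | "length xs = size l" | "length xs > size l"
    by linarith
  then show ?case
  proof cases
    case 1
    then obtain zs where zs: "inorder l = xs @ a # zs" "ys = zs @ x # inorder r"
      using Node.prems(2)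
      by (auto simp: append_eq_append_conv2 Cons_eq_append_conv append_eq_Cons_conv
          dest: arg_cong[of "inorder l" _ length])
    with 1 Node show ?thesis by auto
  next
    case 2
    then show ?thesis using Node.prems by (auto split: if_splits)
  next
    case 3
    then obtain zs where zs: "xs = inorder l @ x # zs" "inorder r = zs @ a # ys"
      using Node.prems(2)
      by (auto simp: append_eq_append_conv2 Cons_eq_append_conv append_eq_Cons_conv
          dest: arg_cong[of "inorder l" _ length])
    with 3 Node show ?thesis by auto
  qed
qed simp


section \<open>The loop\<close>

text \<open>Indexing the leaves from 0, the canopy consists of the positions \<open>0 < k < size s\<close>.\<close>

definition twin_bits :: "'a tree \<Rightarrow> 'b tree \<Rightarrow> bool" where
  "twin_bits s t \<longleftrightarrow> size s = size t \<and>
     (\<forall>k. 0 < k \<and> k < size s \<longrightarrow> leaf_bits 0 s ! k \<noteq> leaf_bits 0 t ! k)"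

lemma canopy_nth:
  assumes "k < size t - 1"
  shows "canopy t ! k = leaf_bits 0 t ! Suc k"
proof -
  have "k < length (butlast (tl (leaf_bits 0 t)))" using assms by simp
  then show ?thesis by (simp add: canopy_def nth_butlast nth_tl)
qed

lemma twin_trees_twin_bits:
  assumes "twin_trees s t"
  shows "twin_bits s t"
  unfolding twin_bits_def
proof (intro conjI allI impI)
  show eq: "size s = size t" using assms by (simp add: twin_trees_def)
  fix k assume "0 < k \<and> k < size s"
  then have k: "k - 1 < size s - 1" "Suc (k - 1) = k" by auto
  then have "canopy s ! (k - 1) \<noteq> canopy t ! (k - 1)"
    using assms by (simp add: twin_trees_def)
  then show "leaf_bits 0 s ! k \<noteq> leaf_bits 0 t ! k"
    using canopy_nth[of "k - 1" s] canopy_nth[of "k - 1" t] k eq by metis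
qed

text \<open>The leaves next to the root of the left tree force the entries 1, 0 in \<open>t\<close>,
  so the node there is childless. Afterwards the merged leaf of \<open>t'\<close> has entry 1 for a
  left child, against the last leaf of \<open>l\<close> (entry 0) kept by \<open>over\<close>, and
  entry 0 otherwise, against the first leaf of \<open>r\<close> (entry 1) kept by
  \<open>under\<close>.\<close>

lemma twin_bits_step:
  assumes "twin_bits (Node l a r) t"
  obtains t' where "suppress (Suc (size l)) t = Some t'"
    "twin_bits (if is_left_child (Suc (size l)) t then over l r else under l r) t'"
proof -
  let ?f = "left_child_flags False t ! size l"
  have sz: "size t = Suc (size l + size r)"
    using assms by (simp add: twin_bits_def)
  then have ne: "t \<noteq> Leaf" by auto
  have tw: "(leaf_bits 1 l @ leaf_bits 0 r) ! k \<noteq> leaf_bits 0 t ! k"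
    if "0 < k" "k \<le> size l + size r" for k
    using assms that by (simp add: twin_bits_def)
  have le1: "leaf_bits 0 t ! k \<le> 1" if "k \<le> size t" for k
    using that leaf_bits_le_1[of 0 k t] by simp
  \<comment> \<open>For empty \<open>l\<close> this is the first leaf of \<open>t\<close>, always a
    left child; otherwise the last leaf of \<open>l\<close> has entry 0 and the twin condition
    applies.\<close>
  have b1: "leaf_bits 0 t ! size l = 1"
  proof (cases "l = Leaf")
    case True
    then show ?thesis using ne by (simp add: leaf_bits_first)
  next
    case False
    then have "0 < size l" by (cases l) auto
    then show ?thesis
      using tw[of "size l"] le1[of "size l"] sz leaf_bits_last[of 1 l] False
      by (simp add: nth_append)
  qed
  have b0: "leaf_bits 0 t ! Suc (size l) = 0"
  proof (cases "r = Leaf")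
    case True
    then show ?thesis using ne sz leaf_bits_last[of 0 t] by simp
  next
    case False
    then have "0 < size r" by (cases r) auto
    then show ?thesis
      using tw[of "Suc (size l)"] le1[of "Suc (size l)"] sz leaf_bits_first[of 0 r] False
      by (simp add: nth_append)
  qed
  obtain t' where t': "suppress (Suc (size l)) t = Some t'" "Suc (size t') = size t"
    "leaf_bits 0 t' = take (size l) (leaf_bits 0 t) @
      of_bool ?f # drop (Suc (Suc (size l))) (leaf_bits 0 t)"
    using suppress_leaf_bits[of "size l" t False] b1 b0 sz by auto
  have lt: "leaf_bits 0 t' ! k = leaf_bits 0 t ! k" if "k < size l" for k
    using that sz t'(3) by (simp add: nth_append)
  have eq: "leaf_bits 0 t' ! size l = of_bool ?f"
    using sz t'(3) by (simp add: nth_append)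
  \<comment> \<open>Two leaves became one, so positions beyond the merged leaf shift by one.\<close>
  have gt: "leaf_bits 0 t' ! k = leaf_bits 0 t ! Suc k" if "size l < k" "k < size t'" for k
  proof -
    obtain m where "k = Suc (size l + m)"
      using less_imp_Suc_add[OF \<open>size l < k\<close>] by auto
    then show ?thesis
      using that sz t'(2,3) by (simp add: nth_append)
  qed
  have over: "leaf_bits 0 (over l r) ! k \<noteq> leaf_bits 0 t' ! k"
    if "0 < k" "k < size l + size r" ?f for k
  proof -
    consider "k < size l" | "k = size l" | "size l < k" by linarith
    then show ?thesis
    proof cases
      case 1
      then have "leaf_bits 0 l = leaf_bits 1 l"
        by (intro leaf_bits_irrelevant) auto
      then show ?thesis
        using 1 that tw[of k] lt[of k] by (auto simp: leaf_bits_over nth_append)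
    next
      case 2
      then have "l \<noteq> Leaf" using that by auto
      then show ?thesis
        using 2 that eq by (simp add: leaf_bits_over nth_append leaf_bits_last)
    next
      case 3
      then show ?thesis
        using that tw[of "Suc k"] gt[of k] sz t'(2)
        by (simp add: leaf_bits_over nth_append nth_tl Suc_diff_Suc)
    qed
  qed
  have under: "leaf_bits 0 (under l r) ! k \<noteq> leaf_bits 0 t' ! k"
    if "0 < k" "k < size l + size r" "\<not> ?f" for k
  proof -
    consider "k < size l" | "k = size l" | "size l < k" by linarith
    then show ?thesis
    proof cases
      case 1
      then have "leaf_bits 0 l = leaf_bits 1 l"
        by (intro leaf_bits_irrelevant) auto
      then show ?thesis
        using 1 that tw[of k] lt[of k] by (simp add: leaf_bits_under nth_append nth_butlast)
    next
      case 2
      then have "r \<noteq> Leaf" using that by auto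
      then show ?thesis
        using 2 that eq by (simp add: leaf_bits_under nth_append leaf_bits_first)
    next
      case 3
      then show ?thesis
        using that tw[of "Suc k"] gt[of k] sz t'(2)
        by (simp add: leaf_bits_under nth_append Suc_diff_le)
    qed
  qed
  have "twin_bits (if is_left_child (Suc (size l)) t then over l r else under l r) t'"
    using over under t'(2) sz
    by (simp add: twin_bits_def is_left_child_def size_over size_under)
  with t'(1) that show thesis by blast
qed

text \<open>The accumulator \<open>u\<close> is arbitrary and \<open>w\<close> is what remains to be
  read. Since \<open>foldr\<close> inserts the first letter last, each insertion undoes one
  suppression.\<close>

lemma extract_loop_twin:
  assumes "twin_bits s t" "left_bst s" "inorder s = inorder t"
  shows "\<exists>w. extract_loop u s t = Some (u @ w) \<and> extraction s w \<and> foldr right_insert w Leaf = t"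
  using assms
proof (induction u s t rule: extract_loop.induct)
  case (1 u t)
  then show ?case by (auto simp: twin_bits_def intro: extraction.intros)
next
  case (2 u l a r)
  then show ?case by simp
next
  case (3 u l a r l' x r')
  let ?t = "Node l' x r'"
  let ?s = "if is_left_child (Suc (size l)) ?t then over l r else under l r"
  obtain t' where t': "suppress (Suc (size l)) ?t = Some t'" "twin_bits ?s t'"
    using twin_bits_step[OF 3(2)] by blast
  have ino: "inorder ?t = inorder l @ a # inorder r"
    using 3(4) by simp
  then have "inorder t' = inorder l @ inorder r"
    using inorder_suppress[OF t'(1)] by simp
  then have "\<exists>w. extract_loop (u @ [a]) ?s t' = Some ((u @ [a]) @ w) \<and> extraction ?s w \<and>
      foldr right_insert w Leaf = t'"
    using 3(1)[of ?t "Suc (size l)" t'] t' left_bst_merge[OF 3(3), of ?s] by simp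
  then obtain w where w: "extract_loop (u @ [a]) ?s t' = Some ((u @ [a]) @ w)" "extraction ?s w"
      "foldr right_insert w Leaf = t'"
    by blast
  \<comment> \<open>The inequalities around \<open>a\<close> come from the left tree, whose root is
    \<open>a\<close>; they transfer through the common inorder reading.\<close>
  have "right_insert a t' = ?t"
    using right_insert_suppress[of "inorder l" ?t t' a "inorder r"] t'(1) ino 3(3) by simp
  moreover have "extraction (Node l a r) (a # w)"
    using w(2) by (auto intro: extraction.intros split: if_splits)
  ultimately show ?case
    using w t'(1) by (intro exI[of _ "a # w"]) (simp del: suppress.simps)
qed

lemma extract_baxter_twin:
  assumes "twin_bsts s t"
  obtains w where "extract_baxter s t = Some w" "extraction s w" "P_symbol w = (s, t)"
  using assms extract_loop_twin[of s t "[]"] twin_trees_twin_bits[of s t]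
  by (auto simp: twin_bsts_def extract_baxter_def P_symbol_def fold_left_insert_extraction)


section \<open>Pattern avoidance\<close>

text \<open>The invariant left behind by the removal of \<open>b\<close>; either part may be empty.
  A search for \<open>b\<close> that turns left at labels \<open>\<ge> b\<close> and right at labels
  \<open>< b\<close> makes all left turns first in \<open>over l r\<close> and all right turns first
  in \<open>under l r\<close>.\<close>

definition separated :: "'a::linorder \<Rightarrow> 'a tree \<Rightarrow> bool" where
  "separated b t \<longleftrightarrow> (\<exists>l r. (t = over l r \<or> t = under l r) \<and>
     (\<forall>x\<in>set_tree l. x < b) \<and> (\<forall>x\<in>set_tree r. b \<le> x))"

lemma separatedI:
  assumes "\<forall>x\<in>set_tree l. x < b" "\<forall>x\<in>set_tree r. b \<le> x"
  shows "separated b (over l r)" "separated b (under l r)"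
  using assms by (auto simp: separated_def)

text \<open>The removed root belongs to one of the two parts, and regrouping the grafts puts what is
  left of that part beside the other one again.\<close>

lemma separated_merge:
  assumes "separated b (Node l x r)" "s = over l r \<or> s = under l r"
  shows "separated b s"
proof -
  obtain A B where AB: "Node l x r = over A B \<or> Node l x r = under A B"
    and A: "\<forall>x\<in>set_tree A. x < b" and B: "\<forall>x\<in>set_tree B. b \<le> x"
    using assms by (auto simp: separated_def)
  \<comment> \<open>All labels lie on one side, so the merged tree is separated with an empty other
    part.\<close>
  have all_less: ?thesis if "A = Node l x r"
    using separatedI[of "over l r" b Leaf] separatedI[of "under l r" b Leaf] A assms(2) that by auto
  have all_ge: ?thesis if "B = Node l x r"
    using separatedI[of Leaf b "over l r"] separatedI[of Leaf b "under l r"] B assms(2) that by auto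
  show ?thesis
  proof (cases "A = Leaf \<or> B = Leaf")
    case True
    then show ?thesis using AB all_less all_ge by auto
  next
    case False
    from AB show ?thesis
    proof
      assume eq: "Node l x r = over A B"
      with False obtain B1 where B1: "B = Node B1 x r" "l = over A B1"
        by (cases B) auto
      have "separated b (over A (over B1 r))" "separated b (over A (under B1 r))"
        "separated b (under A r)"
        using A B B1(1) by (auto intro!: separatedI)
      \<comment> \<open>For nonempty \<open>B1\<close> the two grafts act on different spines and
        commute; for empty \<open>B1\<close>, \<open>l\<close> is \<open>A\<close> and the kind of
        graft changes.\<close>
      moreover have "under l r = under A r \<or> under l r = over A (under B1 r)"
        using B1(2) by (cases B1) auto
      moreover have "over l r = over A (over B1 r)"
        using B1(2) by (simp add: over_assoc)
      ultimately show ?thesis using assms(2) by (elim disjE) simp_all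
    next
      assume eq: "Node l x r = under A B"
      with False obtain A2 where A2: "A = Node l x A2" "r = under A2 B"
        by (cases A) auto
      have "separated b (under (under l A2) B)" "separated b (under (over l A2) B)"
        "separated b (over l B)"
        using A B A2(1) by (auto intro!: separatedI)
      moreover have "over l r = over l B \<or> over l r = under (over l A2) B"
        using A2(2) by (cases A2) auto
      moreover have "under l r = under (under l A2) B"
        using A2(2) by (simp add: under_assoc)
      ultimately show ?thesis using assms(2) by (elim disjE) simp_all
    qed
  qed
qed

text \<open>The search for \<open>b\<close> turns left at \<open>d\<close> and right at
  \<open>a\<close>, which excludes \<open>under\<close>. In \<open>over L R\<close> everything below
  \<open>a\<close> would lie in \<open>L\<close>, but \<open>c\<close> is too large for
  that.\<close>

lemma not_separated_2413:
  assumes "a < b" "b < d" "b < c" "c \<in> set_tree A2"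
  shows "\<not> separated b (Node (Node A1 a A2) d B)"
proof
  assume "separated b (Node (Node A1 a A2) d B)"
  then obtain L R where LR: "Node (Node A1 a A2) d B = over L R \<or> Node (Node A1 a A2) d B = under L R"
    and L: "\<forall>x\<in>set_tree L. x < b" and R: "\<forall>x\<in>set_tree R. b \<le> x"
    by (auto simp: separated_def)
  have out: "d \<notin> set_tree L" "c \<notin> set_tree L" "a \<notin> set_tree R"
    using L R assms by (meson less_asym leD)+
  from LR show False
  proof
    assume eq: "Node (Node A1 a A2) d B = over L R"
    then obtain R1 where R1: "R = Node R1 d B"
      using out(1) by (cases R) auto
    with eq have "Node A1 a A2 = over L R1" by simp
    then show False using out(2,3) R1 assms(4) by (cases R1) auto
  next
    assume "Node (Node A1 a A2) d B = under L R"
    then show False using out(1,3) by (cases L) auto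
  qed
qed

text \<open>Mirror image of \<open>not_separated_2413\<close>: after a right turn at
  \<open>a\<close> and a left turn at \<open>d\<close>, the label \<open>b\<close> is too small for
  \<open>R\<close>.\<close>

lemma not_separated_3142:
  assumes "a < c" "c < d" "b < c" "b \<in> set_tree B1"
  shows "\<not> separated c (Node A a (Node B1 d B2))"
proof
  assume "separated c (Node A a (Node B1 d B2))"
  then obtain L R where LR: "Node A a (Node B1 d B2) = over L R \<or> Node A a (Node B1 d B2) = under L R"
    and L: "\<forall>x\<in>set_tree L. x < c" and R: "\<forall>x\<in>set_tree R. c \<le> x"
    by (auto simp: separated_def)
  have out: "a \<notin> set_tree R" "b \<notin> set_tree R" "d \<notin> set_tree L"
    using L R assms by (meson less_asym leD)+
  from LR show False
  proof
    assume "Node A a (Node B1 d B2) = over L R"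
    then show False using out(1,3) by (cases R) auto
  next
    assume eq: "Node A a (Node B1 d B2) = under L R"
    then obtain L2 where L2: "L = Node A a L2"
      using out(1) by (cases L) auto
    with eq have "Node B1 d B2 = under L2 R" by simp
    then show False using out(2,3) L2 assms(4) by (cases L2) auto
  qed
qed

text \<open>The root of a merged tree is the root of \<open>l\<close> or of \<open>r\<close>, and
  the labels of \<open>r\<close> are too large to be \<open>a\<close>.\<close>

lemma left_bst_descent:
  assumes "left_bst (Node l d r)" "a < d" "over l r = Node l' a r' \<or> under l r = Node l' a r'"
  obtains A1 A2 where "l = Node A1 a A2"
  using assms by (cases l; cases r) auto

lemma left_bst_ascent:
  assumes "left_bst (Node l a r)" "a < d" "over l r = Node l' d r' \<or> under l r = Node l' d r'"
  obtains B1 B2 where "r = Node B1 d B2"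
  using assms by (cases l; cases r) auto

lemma extraction_ConsE:
  assumes "extraction t (a # w)"
  obtains l r s where "t = Node l a r" "extraction s w" "s = over l r \<or> s = under l r"
  using assms by (auto elim: extraction.cases)

text \<open>Search order and separation survive the removal of the prefix \<open>u\<close>. When
  \<open>d\<close> is the root, \<open>a\<close> is its left child, and \<open>c\<close>, between
  \<open>a\<close> and \<open>d\<close> and still to come, lies in the right subtree of
  \<open>a\<close>: the shape excluded by \<open>not_separated_2413\<close>.\<close>

lemma extraction_separated_descent:
  assumes "extraction t w" "w = u @ d # a # v" "left_bst t" "separated b t"
    "a < b" "b < c" "c < d" "c \<in> set v"
  shows False
  using assms
proof (induction u arbitrary: t w)
  case Nil
  obtain l r s where t: "t = Node l d r" "extraction s (a # v)" "s = over l r \<or> s = under l r"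
    using Nil(1,2) by (auto elim: extraction_ConsE)
  obtain l' r' where s: "s = Node l' a r'"
    using t(2) by (auto elim: extraction_ConsE)
  have "a < d" using Nil by (meson less_trans)
  then obtain A1 A2 where l: "l = Node A1 a A2"
    using left_bst_descent[of l d r a l' r'] Nil(3) t(1,3) s by metis
  have "c \<in> set_tree s"
    using extraction_set[OF t(2)] Nil(8) by auto
  then have "c \<in> set_tree l \<union> set_tree r"
    using t(3) by auto
  moreover have "\<forall>x\<in>set_tree A1. x < a" "\<forall>x\<in>set_tree r. d \<le> x" "a < c"
    using Nil(3,5,6) t(1) l by auto
  then have "c \<notin> set_tree A1" "c \<notin> set_tree r" "c \<noteq> a"
    using Nil(7) by (meson less_asym leD less_irrefl)+
  ultimately have "c \<in> set_tree A2"
    using l by simp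
  then show ?case
    using not_separated_2413[of a b d c A2 A1 r] Nil t(1) l by auto
next
  case (Cons y u)
  obtain l r s where t: "t = Node l y r" "extraction s (u @ d # a # v)" "s = over l r \<or> s = under l r"
    using Cons.prems(1,2) by (auto elim: extraction_ConsE)
  show ?case
    using Cons.IH[OF t(2) HOL.refl left_bst_merge[OF _ t(3)] separated_merge[OF _ t(3)] Cons.prems(5-8)]
      Cons.prems(3,4) t(1)
    by blast
qed

lemma extraction_separated_ascent:
  assumes "extraction t w" "w = u @ a # d # v" "left_bst t" "separated c t"
    "a < b" "b < c" "c < d" "b \<in> set v"
  shows False
  using assms
proof (induction u arbitrary: t w)
  case Nil
  obtain l r s where t: "t = Node l a r" "extraction s (d # v)" "s = over l r \<or> s = under l r"
    using Nil(1,2) by (auto elim: extraction_ConsE)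
  obtain l' r' where s: "s = Node l' d r'"
    using t(2) by (auto elim: extraction_ConsE)
  have "a < d" "a < c" using Nil by (meson less_trans)+
  then obtain B1 B2 where r: "r = Node B1 d B2"
    using left_bst_ascent[of l a r d l' r'] Nil(3) t(1,3) s by metis
  have "b \<in> set_tree s"
    using extraction_set[OF t(2)] Nil(8) by auto
  then have "b \<in> set_tree l \<union> set_tree r"
    using t(3) by auto
  moreover have "\<forall>x\<in>set_tree l. x < a" "\<forall>x\<in>set_tree B2. d \<le> x" "b < d"
    using Nil(3,6,7) t(1) r by auto
  then have "b \<notin> set_tree l" "b \<notin> set_tree B2" "b \<noteq> d"
    using Nil(5) by (meson less_asym leD less_irrefl)+
  ultimately have "b \<in> set_tree B1"
    using r by simp
  then show ?case
    using not_separated_3142[of a c d b B1 l B2] Nil t(1) r \<open>a < c\<close> by auto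
next
  case (Cons y u)
  obtain l r s where t: "t = Node l y r" "extraction s (u @ a # d # v)" "s = over l r \<or> s = under l r"
    using Cons.prems(1,2) by (auto elim: extraction_ConsE)
  show ?case
    using Cons.IH[OF t(2) HOL.refl left_bst_merge[OF _ t(3)] separated_merge[OF _ t(3)] Cons.prems(5-8)]
      Cons.prems(3,4) t(1)
    by blast
qed

lemma extraction_avoids:
  assumes "extraction t w" "left_bst t" "w = u @ p # v @ x # y # z" "q \<in> set z"
  shows "\<not> (y < p \<and> p < q \<and> q < x)" "\<not> (x < q \<and> q < p \<and> p < y)"
proof -
  \<comment> \<open>\<open>s\<close> is the merged tree right after the removal of
    \<open>p\<close>.\<close>
  have "\<exists>s. extraction s (v @ x # y # z) \<and> left_bst s \<and> separated p s"
    using assms(1-3)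
  proof (induction u arbitrary: t w)
    case Nil
    then obtain l r s where t: "t = Node l p r" "extraction s (v @ x # y # z)"
      "s = over l r \<or> s = under l r"
      by (auto elim: extraction_ConsE)
    then have "separated p s"
      using Nil(2) by (auto intro: separatedI)
    then show ?case using t(1,2) Nil(2) left_bst_merge[OF _ t(3)] by blast
  next
    case (Cons y' u)
    then obtain l r s where t: "t = Node l y' r" "extraction s (u @ p # v @ x # y # z)"
      "s = over l r \<or> s = under l r"
      by (auto elim: extraction_ConsE)
    show ?case
      using Cons.IH[OF t(2) left_bst_merge[OF _ t(3)] HOL.refl] Cons.prems(2) t(1) by blast
  qed
  then obtain s where s: "extraction s (v @ x # y # z)" "left_bst s" "separated p s"
    by blast
  show "\<not> (y < p \<and> p < q \<and> q < x)"
    using extraction_separated_descent[OF s(1) HOL.refl s(2,3)] assms(4) by blast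
  show "\<not> (x < q \<and> q < p \<and> p < y)"
    using extraction_separated_ascent[OF s(1) HOL.refl s(2,3)] assms(4) by blast
qed

text \<open>Ties are ranked by position, hence the weak inequalities where the smaller letter stands
  first.\<close>

lemma standardization_four:
  shows "standardization [p, x, y, q] = [2, 4, 1, 3] \<Longrightarrow> y < p \<and> p \<le> q \<and> q < x"
    and "standardization [p, x, y, q] = [3, 1, 4, 2] \<Longrightarrow> x \<le> q \<and> q < p \<and> p \<le> y"
proof -
  have card4: "card {j. j < 4 \<and> P j} =
      of_bool (P 0) + of_bool (P 1) + of_bool (P 2) + of_bool (P 3)" for P :: "nat \<Rightarrow> bool"
  proof -
    have "{j. j < 4 \<and> P j} = {..<4} \<inter> {j. P j}" by auto
    then have "card {j. j < 4 \<and> P j} = (\<Sum>j<4. of_bool (P j))"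
      by (simp add: sum_of_bool_eq)
    also have "\<dots> = of_bool (P 0) + of_bool (P 1) + of_bool (P 2) + of_bool (P 3)"
      by (simp add: eval_nat_numeral)
    finally show ?thesis .
  qed
  have len: "length [p, x, y, q] = 4"
    by simp
  have upt: "[0..<4] = [0, 1, 2, 3 :: nat]"
    by (simp add: upt_rec)
  \<comment> \<open>The leading 1 in each rank counts the position itself.\<close>
  have std: "standardization [p, x, y, q] =
    [1 + of_bool (x < p) + of_bool (y < p) + of_bool (q < p),
     1 + of_bool (p \<le> x) + of_bool (y < x) + of_bool (q < x),
     1 + of_bool (p \<le> y) + of_bool (x \<le> y) + of_bool (q < y),
     1 + of_bool (p \<le> q) + of_bool (x \<le> q) + of_bool (y \<le> q)]"
    unfolding standardization_def len upt list.map card4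
    by (simp add: le_less)
  \<comment> \<open>The extreme ranks 1 and 4 decide all three of their comparisons.\<close>
  have split: "(of_bool P + of_bool Q + of_bool R = (0::nat)) \<longleftrightarrow> \<not> P \<and> \<not> Q \<and> \<not> R"
    "(of_bool P + of_bool Q + of_bool R = (3::nat)) \<longleftrightarrow> P \<and> Q \<and> R" for P Q R
    by (cases P; cases Q; cases R; simp)+
  show "y < p \<and> p \<le> q \<and> q < x" if "standardization [p, x, y, q] = [2, 4, 1, 3]"
  proof -
    have r: "of_bool (x < p) + of_bool (y < p) + of_bool (q < p) = (1::nat)"
      "of_bool (p \<le> x) + of_bool (y < x) + of_bool (q < x) = (3::nat)"
      "of_bool (p \<le> y) + of_bool (x \<le> y) + of_bool (q < y) = (0::nat)"
      using that unfolding std by simp_all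
    from r(2,3) have "p \<le> x" "y < x" "q < x" "\<not> p \<le> y"
      unfolding split by blast+
    \<comment> \<open>\<open>y < p\<close> already accounts for the rank 2 of \<open>p\<close>, so
      \<open>q < p\<close> fails.\<close>
    with r(1) show ?thesis by (cases "q < p") (simp_all add: not_le not_less)
  qed
  show "x \<le> q \<and> q < p \<and> p \<le> y" if "standardization [p, x, y, q] = [3, 1, 4, 2]"
  proof -
    have r: "of_bool (x < p) + of_bool (y < p) + of_bool (q < p) = (2::nat)"
      "of_bool (p \<le> x) + of_bool (y < x) + of_bool (q < x) = (0::nat)"
      "of_bool (p \<le> y) + of_bool (x \<le> y) + of_bool (q < y) = (3::nat)"
      using that unfolding std by simp_all
    from r(2,3) have "\<not> p \<le> x" "\<not> q < x" "p \<le> y" "\<not> y < p"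
      unfolding split by (auto simp: not_less)
    with r(1) show ?thesis by (cases "q < p") (simp_all add: not_le not_less)
  qed
qed

lemma extraction_baxter_permutation:
  assumes "extraction t w" "left_bst t" "permutation_labeled t"
  shows "baxter_permutation w"
proof -
  have set: "set w = {1..length w}"
    using assms extraction_set extraction_length by (metis permutation_labeled_def)
  then have "distinct w"
    by (simp add: card_distinct)
  have "standardization [w ! i, w ! j, w ! (j + 1), w ! k] \<notin> {[2, 4, 1, 3], [3, 1, 4, 2]}"
    if ijk: "i < j" "j + 1 < k" "k < length w" for i j k
  proof -
    have "drop (Suc i) w =
        take (j - Suc i) (drop (Suc i) w) @ w ! j # w ! (j + 1) # drop (j + 2) w"
      using ijk id_take_nth_drop[of "j - Suc i" "drop (Suc i) w"]
      by (simp add: Cons_nth_drop_Suc)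
    \<comment> \<open>The factorization required by \<open>extraction_avoids\<close>, with
      \<open>w ! k\<close> among the last letters.\<close>
    then have "w = take i w @ w ! i #
        take (j - Suc i) (drop (Suc i) w) @ w ! j # w ! (j + 1) # drop (j + 2) w"
      using ijk id_take_nth_drop[of i w] by simp
    moreover have "w ! k \<in> set (drop (j + 2) w)"
    proof -
      obtain m where "k = j + 2 + m"
        using ijk less_imp_Suc_add[of "j + 1" k] by auto
      then show ?thesis
        using ijk nth_mem[of m "drop (j + 2) w"] by simp
    qed
    ultimately have avoid: "\<not> (w ! (j + 1) < w ! i \<and> w ! i < w ! k \<and> w ! k < w ! j)"
      "\<not> (w ! j < w ! k \<and> w ! k < w ! i \<and> w ! i < w ! (j + 1))"
      by (rule extraction_avoids[OF assms(1,2)])+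
    \<comment> \<open>Distinctness makes the weak inequalities of
      \<open>standardization_four\<close> strict.\<close>
    have "w ! i \<noteq> w ! k" "w ! j \<noteq> w ! k" "w ! i \<noteq> w ! (j + 1)"
      using ijk \<open>distinct w\<close> by (simp_all add: nth_eq_iff_index_eq)
    then show ?thesis
      using avoid standardization_four[of "w ! i" "w ! j" "w ! (j + 1)" "w ! k"]
      by (auto simp: le_less)
  qed
  then show ?thesis
    using set \<open>distinct w\<close> by (simp add: baxter_permutation_def)
qed

theorem proposition4p12:
  shows "(\<forall>TL TR :: 'a::{linorder, infinite} tree. twin_bsts TL TR \<longrightarrow>
            (\<exists>u. extract_baxter TL TR = Some u \<and> u \<in> encoded_class TL TR)) \<and>
         (\<forall>TL TR :: nat tree.
            twin_bsts TL TR \<and> permutation_labeled TL \<and> permutation_labeled TR \<longrightarrow>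
            (\<exists>u. extract_baxter TL TR = Some u \<and> baxter_permutation u))"
proof (intro conjI allI impI)
  fix TL TR :: "'a tree"
  assume "twin_bsts TL TR"
  then obtain u where "extract_baxter TL TR = Some u" "P_symbol u = (TL, TR)"
    by (rule extract_baxter_twin)
  \<comment> \<open>\<open>u\<close> itself has the required P-symbol, so reflexivity places it in
    the class.\<close>
  then show "\<exists>u. extract_baxter TL TR = Some u \<and> u \<in> encoded_class TL TR"
    by (auto simp: encoded_class_def intro: baxter_cong.refl)
next
  fix TL TR :: "nat tree"
  assume *: "twin_bsts TL TR \<and> permutation_labeled TL \<and> permutation_labeled TR"
  then obtain u where "extract_baxter TL TR = Some u" "extraction TL u"
    by (blast elim: extract_baxter_twin)
  with * show "\<exists>u. extract_baxter TL TR = Some u \<and> baxter_permutation u"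
    by (auto simp: twin_bsts_def intro: extraction_baxter_permutation)
qed

end
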